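(* Let $A_1,\ldots,A_r\in\mathbb{R}_+^{n\times n}$ commute in pairs in max algebra and let $p(x_1,\ldots,x_r)$ be a max polynomial. Then: (i) $\lambda(p(A_1,\ldots,A_r))\leq p(\lambda(A_1),\ldots,\lambda(A_r))$; (ii) $\lambda(A_1\oplus\cdots\oplus A_r)\leq\lambda(A_1)\oplus\cdots\oplus\lambda(A_r)$; (iii) $\lambda(A_1\cdots A_r)\leq\lambda(A_1)\cdots\lambda(A_r)$. Moreover, if the matrices $A_1,\ldots,A_r$ are irreducible, then equality holds in all three relations, that is, $\lambda(p(A_1,\ldots,A_r))=p(\lambda(A_1),\ldots,\lambda(A_r))$, $\lambda(A_1\oplus\cdots\oplus A_r)=\lambda(A_1)\oplus\cdots\oplus\lambda(A_r)$ and $\lambda(A_1\cdots A_r)=\lambda(A_1)\cdots\lambda(A_r)$.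
   Context: Max algebra is the semiring $(\mathbb{R}_+,\oplus,\times)$, where $\mathbb{R}_+=[0,\infty)$, $a\oplus b=\max(a,b)$ and $\times$ is ordinary multiplication. All matrix and matrix-vector operations are over this semiring: $(A\oplus B)_{ij}=\max(a_{ij},b_{ij})$, $(AB)_{ij}=\max_k a_{ik}b_{kj}$, $(Av)_i=\max_k a_{ik}v_k$, and powers are iterated max-algebraic products. An eigenvalue of $A$ is an $\alpha\in\mathbb{R}_+$ for which there is a nonzero $v\in\mathbb{R}_+^n$ with $Av=\alpha v$. The Perron root $\lambda(A)$ is the largest eigenvalue of $A$; it equals the maximal cycle geometric mean $\max_{1\le k\le n}\max_{i_1,\ldots,i_k}(a_{i_1i_2}\cdots a_{i_ki_1})^{1/k}$. A max polynomial is obtained from a real polynomial with nonnegative coefficients by replacing the usual sum by the maximum; $p(A_1,\ldots,A_r)$ is obtained by substituting $A_i$ for $x_i$, with max-algebraic matrix operations and a constant term $c$ read as $cI$. A matrix $A$ is irreducible if its associated digraph (nodes $1,\ldots,n$; edge $(i,j)$ iff $a_{ij}>0$) is strongly connected. *)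

theory Defs
  imports
    "HOL-Analysis.Finite_Cartesian_Product"
    "HOL-Library.Poly_Mapping"
    "Graph_Theory.Digraph_Component"
begin

section \<open>The max-algebra semiring\<close>

text \<open>
  The nonnegative reals with \<open>+\<close> interpreted as maximum and \<open>*\<close> as ordinary multiplication.
  With this instance of \<^class>\<open>comm_semiring_1\<close>, the library operations on
  vectors and matrices (\<open>+\<close>, \<open>\<Sum>\<close>, \<open>**\<close>, \<open>*v\<close>, \<open>*s\<close>, \<open>mat\<close>) with entries
  of this type are the max-algebraic ones, and every sum below is a maximum.
\<close>

typedef maxreal = "{x::real. 0 \<le> x}"
  morphisms real_of_maxreal Abs_maxreal
  by auto

setup_lifting type_definition_maxreal

instantiation maxreal :: comm_semiring_1
begin

lift_definition zero_maxreal :: maxreal is 0 by simp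
lift_definition one_maxreal :: maxreal is 1 by simp
lift_definition plus_maxreal :: "maxreal \<Rightarrow> maxreal \<Rightarrow> maxreal" is max by simp
lift_definition times_maxreal :: "maxreal \<Rightarrow> maxreal \<Rightarrow> maxreal" is "(*)" by simp

instance
  by standard (transfer; simp add: max.assoc max.commute mult.assoc mult.commute
      max_mult_distrib_right max_mult_distrib_left max_absorb2)+

end

instantiation maxreal :: linorder
begin

lift_definition less_eq_maxreal :: "maxreal \<Rightarrow> maxreal \<Rightarrow> bool" is "(\<le>)" .
lift_definition less_maxreal :: "maxreal \<Rightarrow> maxreal \<Rightarrow> bool" is "(<)" .

instance
  by standard (transfer; auto)+

end


section \<open>Eigenvalues and the Perron root\<close>

definition is_eigenvalue :: "maxreal^'n^'n \<Rightarrow> maxreal \<Rightarrow> bool" where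
  "is_eigenvalue A \<alpha> \<longleftrightarrow> (\<exists>v. v \<noteq> 0 \<and> A *v v = \<alpha> *s v)"

definition perron_root :: "maxreal^'n^'n \<Rightarrow> maxreal" where
  "perron_root A = (GREATEST \<alpha>. is_eigenvalue A \<alpha>)"


section \<open>Irreducibility\<close>

definition digraph_of_mat :: "maxreal^'n^'n \<Rightarrow> ('n, 'n \<times> 'n) pre_digraph" where
  "digraph_of_mat A = \<lparr>verts = UNIV, arcs = {(i, j). A $ i $ j > 0}, tail = fst, head = snd\<rparr>"

definition irreducible_mat :: "maxreal^'n^'n \<Rightarrow> bool" where
  "irreducible_mat A \<longleftrightarrow> strongly_connected (digraph_of_mat A)"


section \<open>Products, powers and max polynomials\<close>

text \<open>
  On the type of matrices, the class operations \<open>*\<close>, \<open>1\<close> and \<open>^\<close> act entrywise, so products of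
  lists and powers are defined from the matrix product \<open>**\<close>.
\<close>

definition mat_prod_list :: "('a::semiring_1^'n^'n) list \<Rightarrow> 'a^'n^'n" where
  "mat_prod_list Ms = foldr (**) Ms (mat 1)"

definition mat_power :: "'a::semiring_1^'n^'n \<Rightarrow> nat \<Rightarrow> 'a^'n^'n" where
  "mat_power M k = ((**) M ^^ k) (mat 1)"

text \<open>
  A max polynomial maps exponent vectors (finitely supported functions from variable indices to
  exponents) to nonnegative real coefficients, finitely many of them nonzero.
\<close>

type_synonym max_poly = "(nat \<Rightarrow>\<^sub>0 nat) \<Rightarrow>\<^sub>0 maxreal"

definition vars :: "max_poly \<Rightarrow> nat set" where
  "vars p = (\<Union>m\<in>Poly_Mapping.keys p. Poly_Mapping.keys m)"

definition eval_max_poly :: "max_poly \<Rightarrow> (nat \<Rightarrow> maxreal) \<Rightarrow> maxreal" where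
  "eval_max_poly p x = (\<Sum>m\<in>Poly_Mapping.keys p. Poly_Mapping.lookup p m * (\<Prod>i\<in>Poly_Mapping.keys m. x i ^ Poly_Mapping.lookup m i))"

text \<open>
  The factors of a monomial are multiplied in the order of increasing variable index; the order is
  immaterial when the matrices commute. A coefficient \<open>c\<close> acts through \<open>mat c\<close>, that is, \<open>c I\<close>.
\<close>

definition eval_max_poly_mat :: "max_poly \<Rightarrow> (nat \<Rightarrow> maxreal^'n^'n) \<Rightarrow> maxreal^'n^'n" where
  "eval_max_poly_mat p A =
    (\<Sum>m\<in>Poly_Mapping.keys p. mat (Poly_Mapping.lookup p m) **
       mat_prod_list (map (\<lambda>i. mat_power (A i) (Poly_Mapping.lookup m i)) (sorted_list_of_set (Poly_Mapping.keys m))))"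

end

theory Submission
  imports Defs
begin

text \<open>
  The proof compares Perron roots with the exponential growth of the vectors \<open>A\<^sup>k 1\<close>, where \<open>1\<close>
  is the vector with all entries \<open>1\<close>. Call \<open>b\<close> an upper rate of \<open>A\<close> if \<open>A\<^sup>k 1 \<le> C b\<^sup>k 1\<close> for some
  constant \<open>C\<close> and all \<open>k\<close>, and a lower rate if \<open>c b\<^sup>k 1 \<le> A\<^sup>k 1\<close> for some \<open>c > 0\<close>. No lower rate
  exceeds an upper rate, and no eigenvalue exceeds an upper rate.

  The maximal cycle mean \<open>c\<close> of \<open>A\<close> is an eigenvalue, and every positive \<open>b \<ge> c\<close> is an upper rate,
  because a long walk contains a cycle whose removal costs at most a factor \<open>c\<close> per step
  (\<open>eigenvalue_bounding_growth_exists\<close>). Hence \<open>c\<close> is the Perron root, and the Perron root is an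
  infimum of upper rates. An irreducible matrix has a strictly positive eigenvector for its Perron
  root, so there the Perron root is also a lower rate (\<open>growth_ge_irreducible\<close>).

  If \<open>A\<close> and \<open>B\<close> commute then \<open>(A B)\<^sup>k = A\<^sup>k B\<^sup>k\<close>, and \<open>(A \<oplus> B)\<^sup>k\<close> is the maximum of the
  \<open>A\<^sup>j B\<^sup>k\<^sup>-\<^sup>j\<close>; therefore rates of both kinds are compatible with maxima and products, and by
  induction with every max polynomial \<open>f\<close>. Lower rates give at once
  \<open>f (\<lambda>(A\<^sub>1), \<dots>) \<le> \<lambda>(f (A\<^sub>1, \<dots>))\<close> for irreducible matrices. Upper rates give
  \<open>\<lambda>(f (A\<^sub>1, \<dots>)) \<le> f (\<lambda>(A\<^sub>1) \<oplus> \<epsilon>, \<dots>)\<close> for every \<open>\<epsilon> > 0\<close>, and letting \<open>\<epsilon>\<close> tend to \<open>0\<close> gives the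
  inequality in general. The detour through \<open>\<epsilon>\<close> is forced by the Perron root \<open>0\<close>: a nonzero nilpotent
  matrix does not have \<open>0\<close> as an upper rate. The statements on maxima and on products are the cases
  in which \<open>f\<close> is the sum or the product of the variables (\<open>perron_root_max_poly_expr\<close>).
\<close>

section \<open>Order and multiplication on the max-algebra semiring\<close>

instance maxreal :: dioid
proof
  fix a b :: maxreal
  show "a \<le> b \<longleftrightarrow> (\<exists>c. b = a + c)"
    by (transfer, auto simp: max_def)
qed

instance maxreal :: semiring_1_no_zero_divisors
  by standard (transfer; simp)

lemma maxreal_add_le_iff: "a + b \<le> c \<longleftrightarrow> a \<le> c \<and> b \<le> (c::maxreal)"
  by transfer simp

lemma maxreal_add_eq: "a + b = a \<or> a + b = (b::maxreal)"
  by transfer (auto simp: max_def)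

lemma maxreal_le_add [simp]: "a \<le> a + b" "b \<le> a + (b::maxreal)"
  by (transfer; simp)+

lemma maxreal_inverse_exists:
  assumes "x \<noteq> (0::maxreal)" obtains d where "d * x = 1"
  using assms
proof (transfer fixing: thesis)
  fix x :: real
  assume "0 \<le> x" "x \<noteq> 0" and *: "\<And>d. 0 \<le> d \<Longrightarrow> d * x = 1 \<Longrightarrow> thesis"
  show thesis by (rule *[of "1 / x"]) (use \<open>0 \<le> x\<close> \<open>x \<noteq> 0\<close> in auto)
qed

lemma real_of_maxreal_power: "real_of_maxreal (x ^ k) = real_of_maxreal x ^ k"
  by (induction k) (simp_all add: one_maxreal.rep_eq times_maxreal.rep_eq)

lemma maxreal_root_exists:
  assumes "k > 0" shows "\<exists>y::maxreal. y ^ k = x"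
proof
  have x: "0 \<le> real_of_maxreal x"
    using real_of_maxreal by simp
  show "Abs_maxreal (root k (real_of_maxreal x)) ^ k = x"
    using assms x
    by (subst real_of_maxreal_inject[symmetric], subst real_of_maxreal_power)
       (simp add: Abs_maxreal_inverse)
qed

lemma maxreal_power_mono: "a \<le> b \<Longrightarrow> a ^ k \<le> (b::maxreal) ^ k"
  by (induction k) (auto intro: mult_mono)

lemma maxreal_sum_le_iff:
  fixes f :: "_ \<Rightarrow> maxreal"
  assumes "finite S" shows "sum f S \<le> c \<longleftrightarrow> (\<forall>x\<in>S. f x \<le> c)"
  using assms by (induction S rule: finite_induct) (auto simp: maxreal_add_le_iff)

lemma maxreal_le_sum:
  fixes f :: "_ \<Rightarrow> maxreal"
  assumes "finite S" "x \<in> S" shows "f x \<le> sum f S"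
  using maxreal_sum_le_iff[OF assms(1), of f "sum f S"] assms(2) by simp

lemma maxreal_sum_attained:
  fixes f :: "_ \<Rightarrow> maxreal"
  assumes "finite S" "S \<noteq> {}" obtains x where "x \<in> S" "sum f S = f x"
proof -
  have "\<exists>x\<in>S. sum f S = f x"
    using assms
  proof (induction S rule: finite_ne_induct)
    case (insert y T)
    then show ?case using maxreal_add_eq[of "f y" "sum f T"] by auto
  qed auto
  then show thesis using that by blast
qed

text \<open>
  Exponential rates can be compared in spite of constant factors: if \<open>a > b > 0\<close> then \<open>(a / b)\<^sup>k\<close>
  is unbounded.
\<close>

lemma maxreal_rate_le:
  fixes a b c C :: maxreal
  assumes "c > 0" "\<And>k. c * a ^ k \<le> C * b ^ k"
  shows "a \<le> b"
proof (rule ccontr)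
  assume "\<not> a \<le> b"
  define x y u v where "x = real_of_maxreal a" and "y = real_of_maxreal b"
    and "u = real_of_maxreal c" and "v = real_of_maxreal C"
  have nn: "0 \<le> x" "0 \<le> y" "0 \<le> v"
    using real_of_maxreal unfolding x_def y_def v_def by auto
  have u: "u > 0"
    using assms(1) by (simp add: u_def less_maxreal.rep_eq zero_maxreal.rep_eq)
  have xy: "y < x"
    using \<open>\<not> a \<le> b\<close> by (simp add: x_def y_def less_eq_maxreal.rep_eq)
  have le: "u * x ^ k \<le> v * y ^ k" for k
    using assms(2)[of k]
    by (simp add: less_eq_maxreal.rep_eq times_maxreal.rep_eq real_of_maxreal_power x_def y_def u_def v_def)
  show False
  proof (cases "y = 0")
    case True
    then show False using le[of 1] u xy by (simp add: mult_le_0_iff)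
  next
    case False
    then have y: "y > 0" using nn by simp
    then obtain k where "v / u < (x / y) ^ k"
      using real_arch_pow[of "x / y" "v / u"] xy by (auto simp: field_simps)
    then show False using le[of k] u y by (simp add: field_simps power_divide)
  qed
qed

text \<open>
  This replaces a limit argument: if \<open>a > b\<close>, the maximum on the right can only be attained by
  \<open>K * e\<close>, which is too small for small \<open>e\<close>.
\<close>

lemma maxreal_le_if_le_add_small:
  fixes a b K :: maxreal
  assumes "\<And>e. 0 < e \<Longrightarrow> e \<le> 1 \<Longrightarrow> a \<le> b + K * e"
  shows "a \<le> b"
proof (rule ccontr)
  assume "\<not> a \<le> b"
  then have ab: "b < a" by simp
  have K: "a \<le> K * e" if "0 < e" "e \<le> 1" for e
    using assms[OF that] ab maxreal_add_eq[of b "K * e"] by (metis leD)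
  define x k where "x = real_of_maxreal a" and "k = real_of_maxreal K"
  have "0 < x"
    using ab real_of_maxreal[of b] by (simp add: x_def less_maxreal.rep_eq)
  have "0 \<le> k"
    using real_of_maxreal by (simp add: k_def)
  \<comment> \<open>Any \<open>t\<close> in \<open>(0, 1]\<close> with \<open>k t < x\<close> will do; dividing by \<open>k\<close> itself would fail for \<open>k = 0\<close>.\<close>
  define t where "t = min 1 (x / (2 * k + 1))"
  have t: "0 < t" "t \<le> 1" "k * t < x"
  proof -
    show "0 < t" "t \<le> 1"
      using \<open>0 < x\<close> \<open>0 \<le> k\<close> by (auto simp: t_def)
    have "k * t \<le> k * (x / (2 * k + 1))"
      using \<open>0 \<le> k\<close> by (intro mult_left_mono) (auto simp: t_def)
    also have "\<dots> < x"
      using \<open>0 < x\<close> \<open>0 \<le> k\<close> by (simp add: field_simps add_pos_nonneg)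
    finally show "k * t < x" .
  qed
  have "a \<le> K * Abs_maxreal t"
    using t by (intro K) (auto simp: less_maxreal.rep_eq less_eq_maxreal.rep_eq
        zero_maxreal.rep_eq one_maxreal.rep_eq Abs_maxreal_inverse)
  then show False
    using t by (simp add: less_eq_maxreal.rep_eq times_maxreal.rep_eq Abs_maxreal_inverse x_def k_def)
qed


section \<open>Matrix powers\<close>

lemma mat_power_0 [simp]: "mat_power A 0 = mat 1"
  by (simp add: mat_power_def)

lemma mat_power_Suc: "mat_power A (Suc k) = A ** mat_power A k"
  by (simp add: mat_power_def)

lemma commute_mat_power:
  assumes "B ** A = A ** B" shows "B ** mat_power A k = mat_power A k ** B"
proof (induction k)
  case (Suc k)
  have "B ** mat_power A (Suc k) = (B ** A) ** mat_power A k"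
    by (simp add: mat_power_Suc matrix_mul_assoc)
  also have "\<dots> = A ** (B ** mat_power A k)"
    by (simp add: assms matrix_mul_assoc)
  also have "\<dots> = mat_power A (Suc k) ** B"
    by (simp add: Suc mat_power_Suc matrix_mul_assoc)
  finally show ?case .
qed simp

lemma mat_power_Suc_right: "mat_power A (Suc k) = mat_power A k ** A"
  by (simp add: mat_power_Suc commute_mat_power)

lemma mat_power_add: "mat_power A (k + l) = mat_power A k ** mat_power A l"
  by (induction k) (simp_all add: mat_power_Suc matrix_mul_assoc)

lemma mat_power_mult:
  assumes "A ** B = B ** A"
  shows "mat_power (A ** B) k = mat_power A k ** mat_power B k"
proof (induction k)
  case (Suc k)
  have "mat_power (A ** B) (Suc k) = A ** (B ** mat_power A k) ** mat_power B k"
    by (simp add: mat_power_Suc Suc matrix_mul_assoc)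
  also have "\<dots> = A ** (mat_power A k ** B) ** mat_power B k"
    using commute_mat_power[OF assms[symmetric]] by simp
  finally show ?case
    by (simp add: mat_power_Suc matrix_mul_assoc)
qed simp

lemma mat_entry: "mat c $ i $ j = (if i = j then c else 0)"
  by (simp add: mat_def)

lemma matrix_mult_entry: "(A ** B) $ i $ j = (\<Sum>k\<in>UNIV. A $ i $ k * B $ k $ j)"
  by (simp add: matrix_matrix_mult_def)

lemma matrix_vector_entry: "(A *v v) $ i = (\<Sum>j\<in>UNIV. A $ i $ j * v $ j)"
  by (simp add: matrix_vector_mult_def)

lemma mat_vector_mult:
  fixes v :: "'a::semiring_1^'n"
  shows "mat c *v v = c *s v"
  by (simp add: vec_eq_iff matrix_vector_entry mat_entry if_distrib if_distribR cong: if_cong)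

lemma mat_commute:
  fixes A :: "'a::comm_semiring_1^'n^'n"
  shows "mat c ** A = A ** mat c"
  by (simp add: vec_eq_iff matrix_mult_entry mat_entry if_distrib if_distribR mult.commute cong: if_cong)

lemma matrix_vector_smult:
  fixes A :: "'a::comm_semiring_1^'n^'m"
  shows "A *v (c *s v) = c *s (A *v v)"
  by (simp add: vec_eq_iff matrix_vector_entry sum_distrib_left mult_ac)

lemma matrix_vector_mono:
  fixes A :: "maxreal^'n^'m"
  assumes "v \<le> w" shows "A *v v \<le> A *v w"
  using assms by (auto simp: less_eq_vec_def matrix_vector_entry intro!: sum_mono mult_left_mono)

lemma matrix_vector_mono_left:
  fixes A :: "maxreal^'n^'m"
  assumes "A \<le> B" shows "A *v v \<le> B *v v"
  using assms by (auto simp: less_eq_vec_def matrix_vector_entry intro!: sum_mono mult_right_mono)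

lemma smult_vec_mono:
  fixes v :: "maxreal^'n"
  assumes "v \<le> w" shows "c *s v \<le> c *s w"
  using assms by (auto simp: less_eq_vec_def intro!: mult_left_mono)

lemma smult_vec_mono_left:
  fixes v :: "maxreal^'n"
  assumes "c \<le> d" shows "c *s v \<le> d *s v"
  using assms by (auto simp: less_eq_vec_def intro!: mult_right_mono)

lemma smult_vec_assoc: "c *s (d *s v) = (c * d) *s (v :: 'a::semigroup_mult^'n)"
  by (simp add: vec_eq_iff mult.assoc)

lemma eigenvector_mat_power:
  fixes A :: "maxreal^'n^'n"
  assumes "A *v v = a *s v"
  shows "mat_power A k *v v = a ^ k *s v"
proof (induction k)
  case (Suc k)
  have "mat_power A (Suc k) *v v = A *v (a ^ k *s v)"
    by (simp add: mat_power_Suc Suc flip: matrix_vector_mul_assoc)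
  also have "\<dots> = a ^ Suc k *s v"
    by (simp add: matrix_vector_smult assms smult_vec_assoc mult.commute)
  finally show ?case .
qed (simp add: vec_eq_iff)

lemma mat_power_mat:
  fixes c :: maxreal
  shows "mat_power (mat c :: maxreal^'n^'n) k *v v = c ^ k *s v"
  by (rule eigenvector_mat_power) (rule mat_vector_mult)

lemma mat_power_mono:
  fixes A :: "maxreal^'n^'n"
  assumes "A \<le> B" shows "mat_power A k *v v \<le> mat_power B k *v v"
proof (induction k)
  case (Suc k)
  have "mat_power A (Suc k) *v v \<le> A *v (mat_power B k *v v)"
    by (simp add: mat_power_Suc Suc matrix_vector_mono flip: matrix_vector_mul_assoc)
  also have "\<dots> \<le> mat_power B (Suc k) *v v"
    by (simp add: mat_power_Suc assms matrix_vector_mono_left flip: matrix_vector_mul_assoc)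
  finally show ?case .
qed simp

section \<open>Growth rates\<close>

text \<open>
  On vectors, \<open>1\<close> has all entries equal to \<open>1\<close>, so \<open>mat_power A k *v 1\<close> lists the row maxima of
  \<open>A\<^sup>k\<close>. Since \<open>0 ^ 0 = 1\<close>, the zero matrix has \<open>0\<close> as a rate of both kinds.
\<close>

definition growth_le :: "maxreal^'n^'n \<Rightarrow> maxreal \<Rightarrow> bool" where
  "growth_le A b \<longleftrightarrow> (\<exists>C. \<forall>k. mat_power A k *v 1 \<le> (C * b ^ k) *s 1)"

definition growth_ge :: "maxreal^'n^'n \<Rightarrow> maxreal \<Rightarrow> bool" where
  "growth_ge A b \<longleftrightarrow> (\<exists>c>0. \<forall>k. (c * b ^ k) *s 1 \<le> mat_power A k *v 1)"

lemma growth_ge_imp_le: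
  assumes "growth_ge A a" "growth_le A b" shows "a \<le> b"
proof -
  obtain c where c: "c > 0" "\<And>k. (c * a ^ k) *s 1 \<le> mat_power A k *v 1"
    using assms(1) unfolding growth_ge_def by blast
  obtain C where C: "\<And>k. mat_power A k *v 1 \<le> (C * b ^ k) *s 1"
    using assms(2) unfolding growth_le_def by blast
  have "c * a ^ k \<le> C * b ^ k" for k
    using order_trans[OF c(2) C, of k] by (simp add: less_eq_vec_def)
  with c(1) show ?thesis by (rule maxreal_rate_le)
qed

text \<open>
  An eigenvector is dominated by a multiple of \<open>1\<close>, so it grows no faster than \<open>1\<close> under \<open>A\<close>.
\<close>

lemma eigenvalue_le_growth:
  fixes A :: "maxreal^'n^'n"
  assumes "is_eigenvalue A a" "growth_le A b" shows "a \<le> b"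
proof -
  obtain v where v: "v \<noteq> 0" "A *v v = a *s v"
    using assms(1) unfolding is_eigenvalue_def by blast
  obtain C where C: "\<And>k. mat_power A k *v 1 \<le> (C * b ^ k) *s 1"
    using assms(2) unfolding growth_le_def by blast
  obtain i where i: "v $ i > 0"
    using v(1) by (auto simp: vec_eq_iff zero_less_iff_neq_zero)
  define Z where "Z = (\<Sum>i\<in>UNIV. v $ i)"
  have vZ: "v \<le> Z *s 1"
    by (simp add: less_eq_vec_def Z_def maxreal_le_sum)
  have "v $ i * a ^ k \<le> (Z * C) * b ^ k" for k
  proof -
    have "a ^ k *s v = mat_power A k *v v"
      using eigenvector_mat_power[OF v(2)] by simp
    also have "\<dots> \<le> Z *s (mat_power A k *v 1)"
      using matrix_vector_mono[OF vZ] by (simp add: matrix_vector_smult)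
    also have "\<dots> \<le> Z *s ((C * b ^ k) *s 1)"
      by (intro smult_vec_mono C)
    finally show ?thesis by (simp add: less_eq_vec_def mult_ac)
  qed
  with i show ?thesis by (rule maxreal_rate_le)
qed

lemma growth_le_mat: "growth_le (mat c) c"
  unfolding growth_le_def by (rule exI[of _ 1]) (simp add: mat_power_mat)

lemma growth_ge_mat: "growth_ge (mat c) c"
  unfolding growth_ge_def by (rule exI[of _ 1]) (simp add: mat_power_mat zero_less_iff_neq_zero)

lemma growth_le_mult:
  assumes "A ** B = B ** A" "growth_le A a" "growth_le B b"
  shows "growth_le (A ** B) (a * b)"
proof -
  obtain C D where C: "\<And>k. mat_power A k *v 1 \<le> (C * a ^ k) *s 1"
    and D: "\<And>k. mat_power B k *v 1 \<le> (D * b ^ k) *s 1"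
    using assms(2,3) unfolding growth_le_def by blast
  have "mat_power (A ** B) k *v 1 \<le> (C * D * (a * b) ^ k) *s 1" for k
  proof -
    have "mat_power (A ** B) k *v 1 = mat_power A k *v (mat_power B k *v 1)"
      by (simp add: mat_power_mult[OF assms(1)] matrix_vector_mul_assoc)
    also have "\<dots> \<le> mat_power A k *v ((D * b ^ k) *s 1)"
      by (intro matrix_vector_mono D)
    also have "\<dots> \<le> (D * b ^ k) *s ((C * a ^ k) *s 1)"
      by (simp add: matrix_vector_smult smult_vec_mono C)
    also have "\<dots> = (C * D * (a * b) ^ k) *s 1"
      by (simp add: smult_vec_assoc power_mult_distrib mult_ac)
    finally show ?thesis .
  qed
  then show ?thesis unfolding growth_le_def by blast
qed

lemma growth_ge_mult:
  assumes "A ** B = B ** A" "growth_ge A a" "growth_ge B b"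
  shows "growth_ge (A ** B) (a * b)"
proof -
  obtain c d where c: "c > 0" "\<And>k. (c * a ^ k) *s 1 \<le> mat_power A k *v 1"
    and d: "d > 0" "\<And>k. (d * b ^ k) *s 1 \<le> mat_power B k *v 1"
    using assms(2,3) unfolding growth_ge_def by blast
  have "(c * d * (a * b) ^ k) *s 1 \<le> mat_power (A ** B) k *v 1" for k
  proof -
    have "(c * d * (a * b) ^ k) *s (1::maxreal^'a) = (d * b ^ k) *s ((c * a ^ k) *s 1)"
      by (simp add: smult_vec_assoc power_mult_distrib mult_ac)
    also have "\<dots> \<le> mat_power A k *v ((d * b ^ k) *s 1)"
      by (simp add: matrix_vector_smult smult_vec_mono c)
    also have "\<dots> \<le> mat_power A k *v (mat_power B k *v 1)"
      by (intro matrix_vector_mono d)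
    also have "\<dots> = mat_power (A ** B) k *v 1"
      by (simp add: mat_power_mult[OF assms(1)] matrix_vector_mul_assoc)
    finally show ?thesis .
  qed
  moreover have "c * d > 0"
    using c(1) d(1) by (simp add: zero_less_iff_neq_zero)
  ultimately show ?thesis unfolding growth_ge_def by blast
qed

lemma growth_ge_mono:
  assumes "A \<le> B" "growth_ge A a" shows "growth_ge B a"
  using assms(2) order_trans[OF _ mat_power_mono[OF assms(1)]]
  unfolding growth_ge_def by blast

text \<open>
  The maximum \<open>a + b\<close> is one of \<open>a\<close> and \<open>b\<close>, and \<open>A + B\<close> dominates the matrix with that rate.
\<close>

lemma growth_ge_add:
  assumes "growth_ge A a" "growth_ge B b"
  shows "growth_ge (A + B) (a + b)"
proof -
  have "A \<le> A + B" "B \<le> A + B"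
    by (simp_all add: less_eq_vec_def)
  then show ?thesis
    using maxreal_add_eq[of a b] growth_ge_mono assms by metis
qed

text \<open>
  Expanding \<open>(A + B)\<^sup>k\<close> produces products \<open>A\<^sup>j B\<^sup>l\<close> with \<open>j + l = k\<close>, and there are no binomial
  coefficients because addition is idempotent. The induction keeps the factors already pulled out in the
  general form \<open>A\<^sup>j B\<^sup>l\<close>, so that the expansion need not be written down.
\<close>

lemma growth_le_add:
  fixes A B :: "maxreal^'n^'n"
  assumes "A ** B = B ** A" "growth_le A a" "growth_le B b"
  shows "growth_le (A + B) (a + b)"
proof -
  obtain C D where C: "\<And>k. mat_power A k *v 1 \<le> (C * a ^ k) *s 1"
    and D: "\<And>k. mat_power B k *v 1 \<le> (D * b ^ k) *s 1"
    using assms(2,3) unfolding growth_le_def by blast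
  have "mat_power (A + B) k *v (mat_power A j *v (mat_power B l *v 1)) \<le> (C * D * (a + b) ^ (k + j + l)) *s 1"
    for k j l
  proof (induction k arbitrary: j l)
    case 0
    have "mat_power A j *v (mat_power B l *v 1) \<le> mat_power A j *v ((D * b ^ l) *s 1)"
      by (intro matrix_vector_mono D)
    also have "\<dots> \<le> (D * b ^ l) *s ((C * a ^ j) *s 1)"
      by (simp add: matrix_vector_smult smult_vec_mono C)
    also have "\<dots> = (C * D * (a ^ j * b ^ l)) *s 1"
      by (simp add: smult_vec_assoc mult_ac)
    also have "\<dots> \<le> (C * D * ((a + b) ^ j * (a + b) ^ l)) *s 1"
      by (intro smult_vec_mono_left mult_left_mono mult_mono maxreal_power_mono) auto
    finally show ?case by (simp add: power_add mult.assoc)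
  next
    case (Suc k)
    let ?w = "mat_power A j *v (mat_power B l *v 1) :: maxreal^'n"
    have A: "A *v ?w = mat_power A (Suc j) *v (mat_power B l *v 1)"
      by (simp add: matrix_vector_mul_assoc mat_power_Suc matrix_mul_assoc)
    have "B *v ?w = (B ** mat_power A j) *v (mat_power B l *v 1)"
      by (simp add: matrix_vector_mul_assoc matrix_mul_assoc)
    also have "\<dots> = mat_power A j *v (mat_power B (Suc l) *v 1)"
      by (simp add: commute_mat_power[OF assms(1)[symmetric]] matrix_vector_mul_assoc mat_power_Suc matrix_mul_assoc)
    finally have B: "B *v ?w = mat_power A j *v (mat_power B (Suc l) *v 1)" .
    have "mat_power (A + B) (Suc k) *v ?w = mat_power (A + B) k *v (A *v ?w + B *v ?w)"
      by (simp add: mat_power_Suc_right matrix_vector_mult_add_rdistrib flip: matrix_vector_mul_assoc)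
    also have "\<dots> = mat_power (A + B) k *v (mat_power A (Suc j) *v (mat_power B l *v 1))
        + mat_power (A + B) k *v (mat_power A j *v (mat_power B (Suc l) *v 1))"
      by (simp only: A B matrix_vector_right_distrib)
    also have "\<dots> \<le> (C * D * (a + b) ^ (Suc k + j + l)) *s 1"
      using Suc[of "Suc j" l] Suc[of j "Suc l"]
      by (auto simp: less_eq_vec_def maxreal_add_le_iff)
    finally show ?case .
  qed
  from this[of _ 0 0] show ?thesis
    unfolding growth_le_def by (auto intro!: exI[of _ "C * D"])
qed


section \<open>Walks and cycles\<close>

lemma walk_weight_le_mat_power:
  fixes A :: "maxreal^'n^'n"
  shows "(\<Prod>t<k. A $ f t $ f (Suc t)) \<le> mat_power A k $ f 0 $ f k"
proof (induction k)
  case (Suc k)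
  have "(\<Prod>t<Suc k. A $ f t $ f (Suc t)) \<le> mat_power A k $ f 0 $ f k * A $ f k $ f (Suc k)"
    by (simp add: Suc mult_right_mono)
  also have "\<dots> \<le> mat_power A (Suc k) $ f 0 $ f (Suc k)"
    unfolding mat_power_Suc_right matrix_mult_entry
    by (rule maxreal_le_sum) auto
  finally show ?case .
qed (simp add: mat_entry)

text \<open>
  Only nonzero entries are considered: for \<open>k = 0\<close> and \<open>i \<noteq> j\<close> the entry is \<open>0\<close> and there is no walk.
\<close>

lemma mat_power_attained_by_walk:
  fixes A :: "maxreal^'n^'n"
  assumes "mat_power A k $ i $ j \<noteq> 0"
  shows "\<exists>f. f 0 = i \<and> f k = j \<and> mat_power A k $ i $ j = (\<Prod>t<k. A $ f t $ f (Suc t))"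
  using assms
proof (induction k arbitrary: i)
  case 0
  then show ?case
    by (auto simp: mat_entry intro!: exI[of _ "\<lambda>_. i"] split: if_splits)
next
  case (Suc k)
  obtain x where x: "mat_power A (Suc k) $ i $ j = A $ i $ x * mat_power A k $ x $ j"
    unfolding mat_power_Suc matrix_mult_entry
    using maxreal_sum_attained[of UNIV "\<lambda>x. A $ i $ x * mat_power A k $ x $ j"] by auto
  with Suc.prems have "mat_power A k $ x $ j \<noteq> 0" by auto
  from Suc.IH[OF this] obtain f where f: "f 0 = x" "f k = j"
    "mat_power A k $ x $ j = (\<Prod>t<k. A $ f t $ f (Suc t))" by blast
  show ?case
    by (rule exI[of _ "case_nat i f"])
       (use x f in \<open>simp add: prod.lessThan_Suc_shift del: prod.lessThan_Suc\<close>)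
qed

lemma prod_lessThan_add:
  fixes g :: "nat \<Rightarrow> 'a::comm_monoid_mult"
  shows "(\<Prod>t<a + c. g t) = (\<Prod>t<a. g t) * (\<Prod>t<c. g (a + t))"
  by (induction c) (simp_all add: mult.assoc)

text \<open>
  A heaviest walk of length \<open>m\<close> visits some node twice within its first \<open>CARD('n)\<close> steps. The piece
  between the two visits is a closed walk, of length \<open>l\<close> say, and the remaining two pieces fit together.
\<close>

lemma mat_power_cycle_removal:
  fixes A :: "maxreal^'n^'n"
  assumes "CARD('n) \<le> m"
  shows "\<exists>l x. 1 \<le> l \<and> l \<le> CARD('n) \<and>
    mat_power A m $ i $ j \<le> mat_power A (m - l) $ i $ j * mat_power A l $ x $ x"
proof (cases "mat_power A m $ i $ j = 0")
  case True
  have "1 \<le> CARD('n)" by (simp add: Suc_leI)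
  then show ?thesis using True by (intro exI[of _ 1]) auto
next
  case False
  from mat_power_attained_by_walk[OF False] obtain f where f: "f 0 = i" "f m = j"
    and w: "mat_power A m $ i $ j = (\<Prod>t<m. A $ f t $ f (Suc t))" by blast
  have "\<not> inj_on f {..CARD('n)}"
  proof
    assume "inj_on f {..CARD('n)}"
    then have "card {..CARD('n)} \<le> CARD('n)"
      by (rule card_inj_on_le) auto
    then show False by simp
  qed
  then obtain a b where ab: "a < b" "b \<le> CARD('n)" "f a = f b"
    unfolding inj_on_def by (metis atMost_iff linorder_neqE_nat)
  define l where "l = b - a"
  have l: "1 \<le> l" "l \<le> CARD('n)" "b = a + l" "a + l \<le> m" "l \<le> m"
    using ab assms by (auto simp: l_def)
  define c where "c = m - b"
  have m: "m = a + (l + c)" using l by (simp add: c_def)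
  let ?W = "\<lambda>s k. \<Prod>t<k. A $ f (s + t) $ f (Suc (s + t))"
  have W: "?W s k \<le> mat_power A k $ f s $ f (s + k)" for s k
    using walk_weight_le_mat_power[of A "\<lambda>t. f (s + t)" k] by simp
  have "mat_power A m $ i $ j = ?W 0 a * (?W a l * ?W b c)"
  proof -
    have "mat_power A m $ i $ j = (\<Prod>t<a + (l + c). A $ f t $ f (Suc t))"
      using w m by simp
    then show ?thesis
      by (simp only: prod_lessThan_add l(3) add.assoc add_0)
  qed
  also have "\<dots> = ?W 0 a * ?W b c * ?W a l"
    by (simp add: mult_ac)
  also have "\<dots> \<le> mat_power A a $ i $ f a * mat_power A c $ f a $ j * mat_power A l $ f a $ f a"
    using W[of 0 a] W[of a l] W[of b c] f ab(3) l(3) m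
    by (intro mult_mono) (auto simp: add.assoc)
  also have "\<dots> \<le> mat_power A (m - l) $ i $ j * mat_power A l $ f a $ f a"
  proof (rule mult_right_mono)
    have "m - l = a + c" using m by simp
    then show "mat_power A a $ i $ f a * mat_power A c $ f a $ j \<le> mat_power A (m - l) $ i $ j"
      using maxreal_le_sum[of UNIV "f a" "\<lambda>x. mat_power A a $ i $ x * mat_power A c $ x $ j"]
      by (simp add: mat_power_add matrix_mult_entry)
  qed simp
  finally show ?thesis using l by blast
qed

text \<open>
  Removing cycles repeatedly reduces every power to one of the finitely many powers below \<open>CARD('n)\<close>, and
  each removal of a cycle of length \<open>l\<close> costs at most the factor \<open>c\<^sup>l\<close>.
\<close>

lemma growth_le_if_cycles_le:
  fixes A :: "maxreal^'n^'n"
  assumes cyc: "\<And>l x. 1 \<le> l \<Longrightarrow> l \<le> CARD('n) \<Longrightarrow> mat_power A l $ x $ x \<le> c ^ l"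
    and "c > 0"
  shows "growth_le A c"
proof -
  obtain d where d: "d * c = 1"
    using \<open>c > 0\<close> maxreal_inverse_exists[of c] by blast
  define C where "C = (\<Sum>m<CARD('n). \<Sum>i\<in>UNIV. \<Sum>j\<in>UNIV. mat_power A m $ i $ j * d ^ m)"
  have C: "mat_power A m $ i $ j \<le> C * c ^ m" for m i j
  proof (induction m arbitrary: i j rule: less_induct)
    case (less m)
    show ?case
    proof (cases "m < CARD('n)")
      case True
      have "mat_power A m $ i $ j * d ^ m \<le> (\<Sum>j\<in>UNIV. mat_power A m $ i $ j * d ^ m)"
        by (rule maxreal_le_sum) auto
      also have "\<dots> \<le> (\<Sum>i\<in>UNIV. \<Sum>j\<in>UNIV. mat_power A m $ i $ j * d ^ m)"
        by (rule maxreal_le_sum) auto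
      also have "\<dots> \<le> C"
        unfolding C_def using True
        by (intro maxreal_le_sum[of "{..<CARD('n)}" m
              "\<lambda>m. \<Sum>i\<in>UNIV. \<Sum>j\<in>UNIV. mat_power A m $ i $ j * d ^ m"]) auto
      finally have "mat_power A m $ i $ j * d ^ m * c ^ m \<le> C * c ^ m"
        by (rule mult_right_mono) simp
      then show ?thesis by (simp add: mult.assoc d flip: power_mult_distrib)
    next
      case False
      then obtain l x where l: "1 \<le> l" "l \<le> CARD('n)"
        and le: "mat_power A m $ i $ j \<le> mat_power A (m - l) $ i $ j * mat_power A l $ x $ x"
        using mat_power_cycle_removal[of m A i j] by auto
      note le
      also have "\<dots> \<le> (C * c ^ (m - l)) * c ^ l"
        using l False by (intro mult_mono less cyc) auto
      also have "\<dots> = C * c ^ m"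
        using l False by (simp add: mult.assoc flip: power_add)
      finally show ?thesis .
    qed
  qed
  have "mat_power A k *v 1 \<le> (C * c ^ k) *s 1" for k
    by (simp add: less_eq_vec_def matrix_vector_entry maxreal_sum_le_iff C)
  then show ?thesis unfolding growth_le_def by blast
qed

text \<open>
  The number \<open>c\<close> is the maximal cycle geometric mean. If \<open>c = 0\<close> then \<open>A\<close> is nilpotent, and a nonzero
  column of its last nonzero power is an eigenvector. Otherwise let \<open>d = 1 / c\<close> and let \<open>i\<close> be a
  node on a cycle attaining the maximum: the heaviest weights, in the matrix \<open>d A\<close>, of walks ending
  in \<open>i\<close> form an eigenvector. Indeed one more step gives again a walk into \<open>i\<close>, which can be
  shortened by cycle removal; and a walk with no steps loses nothing by going once around the critical cycle.
\<close>

lemma eigenvalue_bounding_growth_exists: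
  fixes A :: "maxreal^'n^'n"
  shows "\<exists>c. is_eigenvalue A c \<and> (\<forall>b. c \<le> b \<longrightarrow> 0 < b \<longrightarrow> growth_le A b)"
proof -
  let ?n = "CARD('n)"
  have n: "1 \<le> ?n" by (simp add: Suc_leI)
  define S where "S = {1..?n} \<times> (UNIV :: 'n set)"
  have S: "finite S" "S \<noteq> {}" using n by (auto simp: S_def)
  have "\<forall>q\<in>S. \<exists>y. y ^ fst q = mat_power A (fst q) $ snd q $ snd q"
    by (auto simp: S_def intro!: maxreal_root_exists)
  then obtain y where y: "\<And>q. q \<in> S \<Longrightarrow> y q ^ fst q = mat_power A (fst q) $ snd q $ snd q"
    by metis
  define c where "c = (\<Sum>q\<in>S. y q)"
  have cyc: "mat_power A l $ x $ x \<le> c ^ l" if "1 \<le> l" "l \<le> ?n" for l x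
  proof -
    have "(l, x) \<in> S" using that by (simp add: S_def)
    then show ?thesis
      using y[of "(l, x)"] maxreal_power_mono[OF maxreal_le_sum[OF S(1), of "(l, x)" y], of l]
      by (simp add: c_def)
  qed
  obtain l i where li: "1 \<le> l" "l \<le> ?n" "mat_power A l $ i $ i = c ^ l"
  proof -
    obtain q where "q \<in> S" "c = y q"
      using maxreal_sum_attained[OF S, of y] c_def by auto
    then show thesis using that[of "fst q" "snd q"] y[of q] by (auto simp: S_def)
  qed
  have growth: "growth_le A b" if "c \<le> b" "0 < b" for b
    using cyc that order_trans[OF _ maxreal_power_mono[OF that(1)]]
    by (intro growth_le_if_cycles_le) blast+
  have "is_eigenvalue A c"
  proof (cases "c = 0")
    case True
    have nil: "mat_power A ?n = 0"
    proof -
      have "mat_power A ?n $ x $ z = 0" for x z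
      proof -
        obtain k u where ku: "1 \<le> k" "k \<le> ?n"
          "mat_power A ?n $ x $ z \<le> mat_power A (?n - k) $ x $ z * mat_power A k $ u $ u"
          using mat_power_cycle_removal[of ?n A x z] by auto
        have "mat_power A k $ u $ u = 0"
          using cyc[OF ku(1,2), of u] True ku(1) by (simp add: zero_power)
        then show ?thesis using ku(3) by simp
      qed
      then show ?thesis by (simp add: vec_eq_iff)
    qed
    \<comment> \<open>The nonzero power preceding the first vanishing one has a nonzero column, which \<open>A\<close> annihilates.\<close>
    define k where "k = (LEAST k. mat_power A k = 0)"
    have k: "mat_power A k = 0"
      unfolding k_def using nil by (rule LeastI)
    have "k \<noteq> 0"
    proof
      assume "k = 0"
      then have "(mat 1 :: maxreal^'n^'n) $ undefined $ undefined = 0"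
        using k by simp
      then show False by (simp add: mat_entry)
    qed
    then obtain k' where k': "k = Suc k'" by (cases k) auto
    have "mat_power A k' \<noteq> 0"
      using not_less_Least[of k' "\<lambda>k. mat_power A k = 0"] k' k_def by auto
    then obtain x z where xz: "mat_power A k' $ x $ z \<noteq> 0"
      by (auto simp: vec_eq_iff)
    define v where "v = (\<chi> x. mat_power A k' $ x $ z)"
    have "v \<noteq> 0" using xz by (auto simp: v_def vec_eq_iff)
    moreover have "(A *v v) $ x = mat_power A k $ x $ z" for x
      by (simp add: k' mat_power_Suc matrix_mult_entry matrix_vector_entry v_def)
    then have "A *v v = c *s v"
      by (simp add: vec_eq_iff True k)
    ultimately show ?thesis unfolding is_eigenvalue_def by blast
  next
    case False
    obtain d where d: "d * c = 1" using False maxreal_inverse_exists by blast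
    have dc: "c * d ^ Suc k = d ^ k" for k
    proof -
      have "c * d ^ Suc k = (d * c) * d ^ k" by (simp only: power_Suc mult_ac)
      then show ?thesis by (simp add: d)
    qed
    define v where "v = (\<chi> x. \<Sum>k<?n. d ^ k * mat_power A k $ x $ i)"
    have v: "d ^ k * mat_power A k $ x $ i \<le> v $ x" if "k < ?n" for k x
      using that maxreal_le_sum[of "{..<?n}" k "\<lambda>k. d ^ k * mat_power A k $ x $ i"]
      by (simp add: v_def)
    have Av: "(A *v v) $ x = (\<Sum>k<?n. d ^ k * mat_power A (Suc k) $ x $ i)" for x
    proof -
      have "(A *v v) $ x = (\<Sum>z\<in>UNIV. \<Sum>k<?n. A $ x $ z * (d ^ k * mat_power A k $ z $ i))"
        by (simp add: matrix_vector_entry v_def sum_distrib_left)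
      also have "\<dots> = (\<Sum>k<?n. \<Sum>z\<in>UNIV. A $ x $ z * (d ^ k * mat_power A k $ z $ i))"
        by (rule sum.swap)
      also have "\<dots> = (\<Sum>k<?n. d ^ k * mat_power A (Suc k) $ x $ i)"
        by (simp add: mat_power_Suc matrix_mult_entry sum_distrib_left mult_ac)
      finally show ?thesis .
    qed
    have Av_ge: "d ^ k * mat_power A (Suc k) $ x $ i \<le> (A *v v) $ x" if "k < ?n" for k x
      unfolding Av using that by (intro maxreal_le_sum[where f = "\<lambda>k. d ^ k * mat_power A (Suc k) $ x $ i"]) auto
    have "(A *v v) $ x = c * v $ x" for x
    proof (rule antisym)
      \<comment> \<open>Only the walks of length \<open>CARD('n)\<close> are not already among those that define \<open>v\<close>.\<close>
      have "d ^ k * mat_power A (Suc k) $ x $ i \<le> c * v $ x" if k: "k < ?n" for k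
      proof (cases "Suc k < ?n")
        case True
        have "d ^ k * mat_power A (Suc k) $ x $ i = c * (d ^ Suc k * mat_power A (Suc k) $ x $ i)"
          by (simp add: dc del: power_Suc flip: mult.assoc)
        also have "\<dots> \<le> c * v $ x"
          using v[OF True] by (rule mult_left_mono) simp
        finally show ?thesis .
      next
        case False
        then have "Suc k = ?n" using k by simp
        then obtain l u where lu: "1 \<le> l" "l \<le> Suc k"
          "mat_power A (Suc k) $ x $ i \<le> mat_power A (Suc k - l) $ x $ i * mat_power A l $ u $ u"
          using mat_power_cycle_removal[of "Suc k" A x i] by auto
        have "mat_power A l $ u $ u \<le> c ^ l"
          using cyc[of l u] lu \<open>Suc k = ?n\<close> by simp
        then have "mat_power A (Suc k) $ x $ i \<le> mat_power A (Suc k - l) $ x $ i * c ^ l"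
          using order_trans[OF lu(3) mult_left_mono] by simp
        then have "d ^ k * mat_power A (Suc k) $ x $ i \<le> d ^ k * (mat_power A (Suc k - l) $ x $ i * c ^ l)"
          by (rule mult_left_mono) simp
        also have "\<dots> = c * (d ^ (Suc k - l) * mat_power A (Suc k - l) $ x $ i)"
        proof -
          have "d ^ k * c ^ l = c * d ^ (Suc k - l)"
          proof -
            have "d ^ k * c ^ l = c * (d ^ (Suc k - l + l) * c ^ l)"
            proof -
              have "Suc k - l + l = Suc k" using lu(2) by simp
              then show ?thesis using dc[of k] by (simp only: flip: mult.assoc)
            qed
            also have "\<dots> = c * (d ^ (Suc k - l) * (d * c) ^ l)"
              by (simp only: power_add power_mult_distrib mult_ac)
            finally show ?thesis by (simp add: d)
          qed
          then show ?thesis by (metis mult.assoc mult.commute)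
        qed
        also have "\<dots> \<le> c * v $ x"
          using k lu by (intro mult_left_mono v) auto
        finally show ?thesis .
      qed
      then show "(A *v v) $ x \<le> c * v $ x"
        unfolding Av by (simp add: maxreal_sum_le_iff)
    next
      have "c * (d ^ k * mat_power A k $ x $ i) \<le> (A *v v) $ x" if k: "k < ?n" for k
      proof (cases k)
        case (Suc k')
        then show ?thesis
          using Av_ge[of k' x] k dc[of k'] by (simp del: power_Suc flip: mult.assoc)
      next
        case 0
        show ?thesis
        proof (cases "x = i")
          case True
          \<comment> \<open>The critical cycle through \<open>i\<close> has length \<open>l\<close>, hence weight \<open>1\<close> in \<open>d A\<close>.\<close>
          have "c = d ^ (l - 1) * mat_power A (Suc (l - 1)) $ i $ i"
          proof -
            have "d ^ (l - 1) * c ^ l = (d * c) ^ (l - 1) * c"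
              using li(1) by (cases l) (simp_all add: power_mult_distrib mult_ac)
            then show ?thesis using li by (simp add: d)
          qed
          also have "\<dots> \<le> (A *v v) $ i"
            using li n by (intro Av_ge) auto
          finally show ?thesis using 0 True by (simp add: mat_entry)
        qed (simp add: 0 mat_entry)
      qed
      then show "c * v $ x \<le> (A *v v) $ x"
        by (simp add: v_def sum_distrib_left maxreal_sum_le_iff)
    qed
    then have "A *v v = c *s v" by (simp add: vec_eq_iff)
    moreover have "v \<noteq> 0"
      using v[of 0 i] n by (auto simp: mat_entry)
    ultimately show ?thesis unfolding is_eigenvalue_def by blast
  qed
  with growth show ?thesis by blast
qed

section \<open>The Perron root\<close>

lemma perron_root_eigenvalue_and_growth:
  fixes A :: "maxreal^'n^'n"
  shows is_eigenvalue_perron_root: "is_eigenvalue A (perron_root A)"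
    and growth_le_perron_root: "perron_root A \<le> b \<Longrightarrow> 0 < b \<Longrightarrow> growth_le A b"
proof -
  obtain c where c: "is_eigenvalue A c" "\<And>b. c \<le> b \<Longrightarrow> 0 < b \<Longrightarrow> growth_le A b"
    using eigenvalue_bounding_growth_exists by blast
  have "a \<le> c" if "is_eigenvalue A a" for a
  proof (rule maxreal_le_if_le_add_small)
    fix e :: maxreal assume "0 < e"
    then have "growth_le A (c + 1 * e)"
      by (intro c(2)) (auto intro: less_le_trans)
    with that show "a \<le> c + 1 * e" by (rule eigenvalue_le_growth)
  qed
  then have "perron_root A = c"
    unfolding perron_root_def using c(1) by (intro Greatest_equality) auto
  with c show "is_eigenvalue A (perron_root A)" "perron_root A \<le> b \<Longrightarrow> 0 < b \<Longrightarrow> growth_le A b"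
    by auto
qed

lemma growth_ge_le_perron_root:
  assumes "growth_ge A a" shows "a \<le> perron_root A"
proof (rule maxreal_le_if_le_add_small)
  fix e :: maxreal assume "0 < e"
  then have "growth_le A (perron_root A + 1 * e)"
    by (intro growth_le_perron_root) (auto intro: less_le_trans)
  with assms show "a \<le> perron_root A + 1 * e" by (rule growth_ge_imp_le)
qed

text \<open>
  Positivity propagates backwards along edges: \<open>a v\<^sub>x \<ge> A\<^sub>x\<^sub>y v\<^sub>y > 0\<close> forces \<open>v\<^sub>x > 0\<close>. This also covers
  the eigenvalue \<open>0\<close>, since then the graph has no edges and, being strongly connected, only one node.
\<close>

lemma irreducible_eigenvector_pos:
  fixes A :: "maxreal^'n^'n"
  assumes irr: "irreducible_mat A" and v: "v \<noteq> 0" "A *v v = a *s v"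
  shows "v $ i > 0"
proof -
  obtain j where j: "v $ j > 0"
    using v(1) by (auto simp: vec_eq_iff zero_less_iff_neq_zero)
  have "(i, j) \<in> (arcs_ends (digraph_of_mat A))\<^sup>*"
    using irr unfolding irreducible_mat_def strongly_connected_def reachable_def
    by (auto simp: digraph_of_mat_def intro: rtrancl_on_rtranclI)
  then show ?thesis
  proof (induction rule: converse_rtrancl_induct)
    case (step x y)
    then have "A $ x $ y > 0"
      by (auto simp: arcs_ends_def arc_to_ends_def digraph_of_mat_def)
    then have "0 < A $ x $ y * v $ y"
      using step by (simp add: zero_less_iff_neq_zero)
    also have "\<dots> \<le> (A *v v) $ x"
      unfolding matrix_vector_entry by (rule maxreal_le_sum) auto
    finally show ?case by (simp add: v(2) zero_less_iff_neq_zero)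
  qed (rule j)
qed

text \<open>
  A positive eigenvector is squeezed between two positive multiples of \<open>1\<close>, so \<open>1\<close> grows as it does.
\<close>

lemma growth_ge_irreducible:
  fixes A :: "maxreal^'n^'n"
  assumes "irreducible_mat A" shows "growth_ge A (perron_root A)"
proof -
  obtain v where v: "v \<noteq> 0" "A *v v = perron_root A *s v"
    using is_eigenvalue_perron_root[of A] unfolding is_eigenvalue_def by blast
  have pos: "v $ i > 0" for i
    using irreducible_eigenvector_pos assms v by blast
  define Z where "Z = (\<Sum>i\<in>UNIV. v $ i)"
  have vZ: "v \<le> Z *s 1"
    by (simp add: less_eq_vec_def Z_def maxreal_le_sum)
  have "Z > 0"
    using pos[of undefined] vZ by (auto simp: less_eq_vec_def intro: less_le_trans)
  then obtain d where d: "d * Z = 1" using maxreal_inverse_exists[of Z] by blast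
  define w where "w = Min (range (\<lambda>i. v $ i))"
  have w: "w *s 1 \<le> v" by (simp add: less_eq_vec_def w_def)
  have "w > 0" using pos by (simp add: w_def)
  then have "d * w > 0" using d by (auto simp: zero_less_iff_neq_zero)
  moreover have "(d * w * perron_root A ^ k) *s 1 \<le> mat_power A k *v 1" for k
  proof -
    have "(d * w * perron_root A ^ k) *s (1::maxreal^'n) = (d * perron_root A ^ k) *s (w *s 1)"
      by (simp add: smult_vec_assoc mult_ac)
    also have "\<dots> \<le> (d * perron_root A ^ k) *s v"
      by (intro smult_vec_mono w)
    also have "\<dots> = d *s (mat_power A k *v v)"
      by (simp add: eigenvector_mat_power[OF v(2)] smult_vec_assoc)
    also have "\<dots> \<le> d *s (mat_power A k *v (Z *s 1))"
      by (intro smult_vec_mono matrix_vector_mono vZ)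
    also have "\<dots> = mat_power A k *v 1"
      by (simp add: matrix_vector_smult smult_vec_assoc d vec_eq_iff)
    finally show ?thesis .
  qed
  ultimately show ?thesis unfolding growth_ge_def by blast
qed


section \<open>Max polynomials in commuting matrices\<close>

text \<open>
  \<open>max_poly_expr A I M f\<close> means that one and the same max-algebraic expression in variables indexed by
  \<open>I\<close> yields \<open>M\<close> at the matrices \<open>A\<close> and the function \<open>f\<close> at scalars. Building both in
  parallel lets a single induction treat sums, products and max polynomials in normal form alike.
\<close>

inductive max_poly_expr ::
  "(nat \<Rightarrow> maxreal^'n^'n) \<Rightarrow> nat set \<Rightarrow> maxreal^'n^'n \<Rightarrow> ((nat \<Rightarrow> maxreal) \<Rightarrow> maxreal) \<Rightarrow> bool"
  for A I where
  var: "i \<in> I \<Longrightarrow> max_poly_expr A I (A i) (\<lambda>x. x i)"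
| const: "max_poly_expr A I (mat c) (\<lambda>x. c)"
| add: "max_poly_expr A I M f \<Longrightarrow> max_poly_expr A I N g \<Longrightarrow> max_poly_expr A I (M + N) (\<lambda>x. f x + g x)"
| mult: "max_poly_expr A I M f \<Longrightarrow> max_poly_expr A I N g \<Longrightarrow> max_poly_expr A I (M ** N) (\<lambda>x. f x * g x)"

lemma matrix_mult_add_left:
  fixes A B :: "'a::semiring_1^'n^'m"
  shows "(A + B) ** C = A ** C + B ** C"
  by (simp add: vec_eq_iff matrix_mult_entry distrib_right sum.distrib)

lemma max_poly_expr_commute_left:
  assumes "max_poly_expr A I M f" "\<And>i. i \<in> I \<Longrightarrow> X ** A i = A i ** X"
  shows "X ** M = M ** X"
  using assms(1)
proof induction
  case (mult M f N g)
  then show ?case by (metis matrix_mul_assoc)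
qed (simp_all add: assms(2) mat_commute matrix_add_ldistrib matrix_mult_add_left)

lemma max_poly_expr_commute:
  assumes "\<And>i j. i \<in> I \<Longrightarrow> j \<in> I \<Longrightarrow> A i ** A j = A j ** A i"
    and "max_poly_expr A I M f" "max_poly_expr A I N g"
  shows "M ** N = N ** M"
  using assms(3)
proof (rule max_poly_expr_commute_left)
  fix i assume "i \<in> I"
  then show "M ** A i = A i ** M"
    using max_poly_expr_commute_left[OF assms(2), of "A i"] assms(1) by metis
qed

lemma growth_le_max_poly_expr:
  assumes "\<And>i j. i \<in> I \<Longrightarrow> j \<in> I \<Longrightarrow> A i ** A j = A j ** A i"
    and "max_poly_expr A I M f"
    and "\<And>i. i \<in> I \<Longrightarrow> growth_le (A i) (x i)"
  shows "growth_le M (f x)"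
  using assms(2)
  by induction (auto intro!: assms(3) growth_le_mat growth_le_add growth_le_mult max_poly_expr_commute[OF assms(1)])

lemma growth_ge_max_poly_expr:
  assumes "\<And>i j. i \<in> I \<Longrightarrow> j \<in> I \<Longrightarrow> A i ** A j = A j ** A i"
    and "max_poly_expr A I M f"
    and "\<And>i. i \<in> I \<Longrightarrow> growth_ge (A i) (x i)"
  shows "growth_ge M (f x)"
  using assms(2)
  by induction (auto intro!: assms(3) growth_ge_mat growth_ge_add growth_ge_mult max_poly_expr_commute[OF assms(1)])

text \<open>
  Continuity of \<open>f\<close> at \<open>x\<close> from above, with a linear modulus. The sum \<open>x i + e\<close> is a maximum, and the bound
  \<open>e \<le> 1\<close> absorbs the higher powers of \<open>e\<close> that products create.
\<close>

lemma max_poly_expr_perturb: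
  assumes "max_poly_expr A I M f"
  shows "\<exists>K. \<forall>e\<le>1. f (\<lambda>i. x i + e) \<le> f x + K * e"
  using assms
proof induction
  case (var i)
  show ?case by (rule exI[of _ 1]) simp
next
  case (const c)
  show ?case by simp
next
  case (add M f N g)
  then obtain K L where K: "\<And>e. e \<le> 1 \<Longrightarrow> f (\<lambda>i. x i + e) \<le> f x + K * e"
    and L: "\<And>e. e \<le> 1 \<Longrightarrow> g (\<lambda>i. x i + e) \<le> g x + L * e" by blast
  have "f (\<lambda>i. x i + e) + g (\<lambda>i. x i + e) \<le> f x + g x + (K + L) * e" if "e \<le> 1" for e
    using add_mono[OF K[OF that] L[OF that]] by (simp add: algebra_simps)
  then show ?case by blast
next
  case (mult M f N g)
  then obtain K L where K: "\<And>e. e \<le> 1 \<Longrightarrow> f (\<lambda>i. x i + e) \<le> f x + K * e"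
    and L: "\<And>e. e \<le> 1 \<Longrightarrow> g (\<lambda>i. x i + e) \<le> g x + L * e" by blast
  have "f (\<lambda>i. x i + e) * g (\<lambda>i. x i + e) \<le> f x * g x + (f x * L + K * g x + K * L) * e" if e: "e \<le> 1" for e
  proof -
    have "f (\<lambda>i. x i + e) * g (\<lambda>i. x i + e) \<le> (f x + K * e) * (g x + L * e)"
      using K[OF e] L[OF e] by (rule mult_mono) auto
    also have "\<dots> = f x * g x + (f x * L + K * g x) * e + K * L * e * e"
      by (simp add: algebra_simps)
    also have "\<dots> \<le> f x * g x + (f x * L + K * g x) * e + K * L * e * 1"
      using e by (intro add_left_mono mult_left_mono) auto
    finally show ?thesis by (simp add: algebra_simps)
  qed
  then show ?case by blast
qed

text \<open>
  Adding \<open>e > 0\<close> makes each \<open>perron_root (A i) + e\<close> positive and hence an upper rate of \<open>A i\<close>; the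
  perturbation is then removed by letting \<open>e\<close> tend to \<open>0\<close>. For irreducible matrices the
  Perron roots themselves are lower rates, which gives the reverse inequality directly.
\<close>

theorem perron_root_max_poly_expr:
  fixes A :: "nat \<Rightarrow> maxreal^'n^'n"
  assumes comm: "\<And>i j. i \<in> I \<Longrightarrow> j \<in> I \<Longrightarrow> A i ** A j = A j ** A i"
    and M: "max_poly_expr A I M f"
  shows perron_root_max_poly_expr_le: "perron_root M \<le> f (\<lambda>i. perron_root (A i))"
    and perron_root_max_poly_expr_eq:
      "(\<And>i. i \<in> I \<Longrightarrow> irreducible_mat (A i)) \<Longrightarrow> perron_root M = f (\<lambda>i. perron_root (A i))"
proof -
  let ?x = "\<lambda>i. perron_root (A i)"
  obtain K where K: "\<forall>e\<le>1. f (\<lambda>i. ?x i + e) \<le> f ?x + K * e"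
    using max_poly_expr_perturb[OF M, of ?x] ..
  show le: "perron_root M \<le> f ?x"
  proof (rule maxreal_le_if_le_add_small)
    fix e :: maxreal assume e: "0 < e" "e \<le> 1"
    have "growth_le M (f (\<lambda>i. ?x i + e))"
    proof (rule growth_le_max_poly_expr[OF comm M])
      show "growth_le (A i) (?x i + e)" for i
        using e by (intro growth_le_perron_root) (auto intro: less_le_trans)
    qed
    with is_eigenvalue_perron_root[of M] have "perron_root M \<le> f (\<lambda>i. ?x i + e)"
      by (rule eigenvalue_le_growth)
    also have "\<dots> \<le> f ?x + K * e" using K e(2) by simp
    finally show "perron_root M \<le> f ?x + K * e" .
  qed
  assume irr: "\<And>i. i \<in> I \<Longrightarrow> irreducible_mat (A i)"
  have "growth_ge M (f ?x)"
    by (rule growth_ge_max_poly_expr[OF comm M]) (simp_all add: irr growth_ge_irreducible)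
  then show "perron_root M = f ?x"
    using growth_ge_le_perron_root[of M "f ?x"] le by simp
qed

lemma max_poly_expr_sum:
  assumes "\<And>s. s \<in> S \<Longrightarrow> max_poly_expr A I (M s) (f s)"
  shows "max_poly_expr A I (\<Sum>s\<in>S. M s) (\<lambda>x. \<Sum>s\<in>S. f s x)"
  using assms
proof (induction S rule: infinite_finite_induct)
  case (insert s S)
  then have "max_poly_expr A I (M s + sum M S) (\<lambda>x. f s x + (\<Sum>s\<in>S. f s x))"
    by (intro max_poly_expr.add) auto
  then show ?case using insert.hyps by simp
qed (use max_poly_expr.const[of A I 0] in simp_all)

lemma max_poly_expr_mat_prod_list:
  assumes "\<And>s. s \<in> set ss \<Longrightarrow> max_poly_expr A I (M s) (f s)" "distinct ss"
  shows "max_poly_expr A I (mat_prod_list (map M ss)) (\<lambda>x. \<Prod>s\<in>set ss. f s x)"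
  using assms
proof (induction ss)
  case Nil
  show ?case using max_poly_expr.const[of A I 1] by (simp add: mat_prod_list_def)
next
  case (Cons s ss)
  then have "max_poly_expr A I (M s ** mat_prod_list (map M ss)) (\<lambda>x. f s x * (\<Prod>s\<in>set ss. f s x))"
    by (intro max_poly_expr.mult) auto
  then show ?case using Cons.prems by (simp add: mat_prod_list_def)
qed

lemma max_poly_expr_mat_power:
  assumes "max_poly_expr A I M f"
  shows "max_poly_expr A I (mat_power M k) (\<lambda>x. f x ^ k)"
proof (induction k)
  case 0
  show ?case using max_poly_expr.const[of A I 1] by simp
next
  case (Suc k)
  then show ?case using max_poly_expr.mult[OF assms] by (simp add: mat_power_Suc)
qed

lemma max_poly_expr_eval:
  assumes "vars p \<subseteq> I"
  shows "max_poly_expr A I (eval_max_poly_mat p A) (eval_max_poly p)"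
proof -
  have "max_poly_expr A I
      (mat (Poly_Mapping.lookup p m) ** mat_prod_list (map (\<lambda>i. mat_power (A i) (Poly_Mapping.lookup m i))
        (sorted_list_of_set (Poly_Mapping.keys m))))
      (\<lambda>x. Poly_Mapping.lookup p m * (\<Prod>i\<in>Poly_Mapping.keys m. x i ^ Poly_Mapping.lookup m i))"
    if m: "m \<in> Poly_Mapping.keys p" for m
  proof (rule max_poly_expr.mult[OF max_poly_expr.const])
    have "i \<in> I" if "i \<in> Poly_Mapping.keys m" for i
      using that m assms by (auto simp: vars_def)
    then show "max_poly_expr A I
      (mat_prod_list (map (\<lambda>i. mat_power (A i) (Poly_Mapping.lookup m i)) (sorted_list_of_set (Poly_Mapping.keys m))))
      (\<lambda>x. \<Prod>i\<in>Poly_Mapping.keys m. x i ^ Poly_Mapping.lookup m i)"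
      using max_poly_expr_mat_prod_list[of "sorted_list_of_set (Poly_Mapping.keys m)" A I
        "\<lambda>i. mat_power (A i) (Poly_Mapping.lookup m i)" "\<lambda>i x. x i ^ Poly_Mapping.lookup m i"]
      by (simp add: max_poly_expr_mat_power max_poly_expr.var)
  qed
  then have "max_poly_expr A I (eval_max_poly_mat p A) (\<lambda>x. eval_max_poly p x)"
    unfolding eval_max_poly_mat_def eval_max_poly_def by (rule max_poly_expr_sum)
  then show ?thesis by simp
qed

theorem corollary3p7:
  fixes A :: "nat \<Rightarrow> maxreal^'n^'n" and r :: nat and p :: max_poly
  assumes "r \<ge> 1"
    and "\<forall>i\<in>{1..r}. \<forall>j\<in>{1..r}. A i ** A j = A j ** A i"
    and "vars p \<subseteq> {1..r}"
  shows "perron_root (eval_max_poly_mat p A) \<le> eval_max_poly p (\<lambda>i. perron_root (A i)) \<and>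
    perron_root (\<Sum>i=1..r. A i) \<le> (\<Sum>i=1..r. perron_root (A i)) \<and>
    perron_root (mat_prod_list (map A [1..<Suc r])) \<le> (\<Prod>i=1..r. perron_root (A i)) \<and>
    ((\<forall>i\<in>{1..r}. irreducible_mat (A i)) \<longrightarrow>
      perron_root (eval_max_poly_mat p A) = eval_max_poly p (\<lambda>i. perron_root (A i)) \<and>
      perron_root (\<Sum>i=1..r. A i) = (\<Sum>i=1..r. perron_root (A i)) \<and>
      perron_root (mat_prod_list (map A [1..<Suc r])) = (\<Prod>i=1..r. perron_root (A i)))"
proof -
  let ?I = "{1..r}"
  have comm: "A i ** A j = A j ** A i" if "i \<in> ?I" "j \<in> ?I" for i j
    using assms(2) that by blast
  have expr: "max_poly_expr A ?I (eval_max_poly_mat p A) (eval_max_poly p)"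
    "max_poly_expr A ?I (\<Sum>i=1..r. A i) (\<lambda>x. \<Sum>i=1..r. x i)"
    "max_poly_expr A ?I (mat_prod_list (map A [1..<Suc r])) (\<lambda>x. \<Prod>i=1..r. x i)"
  proof -
    show "max_poly_expr A ?I (eval_max_poly_mat p A) (eval_max_poly p)"
      using assms(3) by (rule max_poly_expr_eval)
    show "max_poly_expr A ?I (\<Sum>i=1..r. A i) (\<lambda>x. \<Sum>i=1..r. x i)"
      by (intro max_poly_expr_sum max_poly_expr.var)
    have "set [1..<Suc r] = ?I" by auto
    then show "max_poly_expr A ?I (mat_prod_list (map A [1..<Suc r])) (\<lambda>x. \<Prod>i=1..r. x i)"
      using max_poly_expr_mat_prod_list[of "[1..<Suc r]" A ?I A "\<lambda>i x. x i"]
      by (simp add: max_poly_expr.var del: upt_Suc)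
  qed
  have le: "perron_root M \<le> f (\<lambda>i. perron_root (A i))" if "max_poly_expr A ?I M f" for M f
    using comm that by (rule perron_root_max_poly_expr_le)
  have eq: "perron_root M = f (\<lambda>i. perron_root (A i))"
    if irr: "\<forall>i\<in>?I. irreducible_mat (A i)" and expr: "max_poly_expr A ?I M f" for M f
    by (rule perron_root_max_poly_expr_eq[OF comm expr]) (simp_all only: irr)
  show ?thesis
    by (intro conjI impI le[OF expr(1)] le[OF expr(2)] le[OF expr(3)]
        eq[OF _ expr(1)] eq[OF _ expr(2)] eq[OF _ expr(3)])
qed

end
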